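(* Let $V\in\mathbb R^{n\times n}$ satisfy $\|I-VV^{\top}\|_2<1$. Let $Y_0=VV^{\top}$, $Z_0=I$, and for $k\ge 0$ $$Y_{k+1}=\tfrac12 Y_k(3I-Z_kY_k),\qquad Z_{k+1}=\tfrac12(3I-Z_kY_k)Z_k .$$ Then after $k^\star$ steps of this iteration, $$\|Z_{k^\star}V\|_2\ \le\ 1+\frac{\|V\|_2}{\sqrt{\rho_{\min}(VV^{\top})}}\Big(1-\sqrt{1-\|I-VV^{\top}\|_2^{2^{k^\star}}}\Big)\ \le\ 1+\frac{\|V\|_2}{\sqrt{\rho_{\min}(VV^{\top})}}\,\|I-VV^{\top}\|_2^{2^{k^\star}},$$ where $\rho_{\min}(VV^\top)$ is the smallest eigenvalue of $VV^\top$.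
   Context: $\|\cdot\|_2$ applied to a matrix is the spectral norm (largest singular value). $I$ is the $n\times n$ identity. The exponent in $\|I-VV^\top\|_2^{2^{k^\star}}$ is $2^{k^\star}$; $k^\star$ is a nonnegative integer. *)

theory Defs
  imports "HOL-Analysis.Analysis"
begin

definition eigenvalues :: "real ^ 'n ^ 'n \<Rightarrow> real set" where
  "eigenvalues A = {l. \<exists>v. v \<noteq> 0 \<and> A *v v = l *\<^sub>R v}"

(* For symmetric A the set of real eigenvalues is the full spectrum and is finite and
   nonempty, so Min is attained; the notion is only meant for such A. *)
definition rho_min :: "real ^ 'n ^ 'n \<Rightarrow> real" where
  "rho_min A = Min (eigenvalues A)"

definition singular_values :: "real ^ 'n ^ 'm \<Rightarrow> real set" where
  "singular_values A = sqrt ` eigenvalues (transpose A ** A)"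

(* The eigenvalues of the Gram matrix are nonnegative, finite in number, and at least one
   exists, so Max is the genuine largest singular value for every A. *)
definition spectral_norm :: "real ^ 'n ^ 'm \<Rightarrow> real" where
  "spectral_norm A = Max (singular_values A)"

end

(*
  The iterates are polynomials in S = V V^T, so everything commutes, and the residual
  R_k = I - Z_k S Z_k satisfies R_(k+1) = (3 R_k^2 + R_k^3) / 4; hence ||R_k|| <= E, where
  E = ||I - S||^(2^k).  A nonzero eigenvalue of the Gram matrix of Z_k V is an eigenvalue
  of Z_k S Z_k = I - R_k, so ||Z_k V|| <= sqrt (1 + E) <= 2 - sqrt (1 - E).  This suffices
  since ||V|| / sqrt (rho_min S) >= 1.
*)
theory Submission
  imports Defs
begin

section \<open>Eigenvalues of symmetric matrices\<close>

lemma inner_transpose_right: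
  fixes A :: "real ^ 'n ^ 'm"
  shows "x \<bullet> (transpose A *v y) = (A *v x) \<bullet> y"
  by (metis dot_lmul_matrix inner_commute transpose_matrix_vector)

lemma gram_symmetric: "transpose (transpose A ** A) = transpose A ** (A :: real ^ 'n ^ 'm)"
  by (simp add: matrix_transpose_mul)

text \<open>Symmetry makes eigenvectors of distinct eigenvalues orthogonal, and a pairwise
  orthogonal set in finite dimension is finite. Finiteness is what gives \<open>Min\<close> and
  \<open>Max\<close> in the definitions their meaning.\<close>

lemma eigenvalues_finite:
  fixes M :: "real ^ 'n ^ 'n"
  assumes "transpose M = M"
  shows "finite (eigenvalues M)"
proof -
  define v where "v l = (SOME v. v \<noteq> 0 \<and> M *v v = l *\<^sub>R v)" for l
  have v: "v l \<noteq> 0 \<and> M *v v l = l *\<^sub>R v l" if "l \<in> eigenvalues M" for l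
    unfolding v_def by (rule someI_ex) (use that in \<open>simp add: eigenvalues_def\<close>)
  have orth: "v l \<bullet> v m = 0" if "l \<in> eigenvalues M" "m \<in> eigenvalues M" "l \<noteq> m" for l m
  proof -
    have "v l \<bullet> (M *v v m) = (M *v v l) \<bullet> v m"
      using inner_transpose_right[of "v l" M "v m"] assms by simp
    then have "m * (v l \<bullet> v m) = l * (v l \<bullet> v m)"
      using v that by simp
    with that show ?thesis by simp
  qed
  have "inj_on v (eigenvalues M)"
    by (rule inj_onI) (metis orth v inner_eq_zero_iff)
  moreover have "finite (v ` eigenvalues M)"
    by (rule pairwise_orthogonal_imp_finite) (auto simp: pairwise_def orthogonal_def intro!: orth)
  ultimately show ?thesis
    using finite_imageD by blast
qed

text \<open>The vector \<open>v\<close> minimises the nonnegative form of \<open>B\<close>, so the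
  first variation at \<open>v\<close> vanishes in every direction; the direction
  \<open>B *v v\<close> itself gives the claim.\<close>

lemma psd_null_vector:
  fixes B :: "real ^ 'n ^ 'n"
  assumes sym: "transpose B = B"
    and psd: "\<And>x. 0 \<le> x \<bullet> (B *v x)"
    and v: "v \<bullet> (B *v v) = 0"
  shows "B *v v = 0"
proof -
  define w where "w = B *v v"
  have sw: "v \<bullet> (B *v w) = w \<bullet> w"
    using inner_transpose_right[of v B w] sym by (simp add: w_def)
  define a where "a = w \<bullet> w"
  define b where "b = w \<bullet> (B *v w)"
  have quad: "0 \<le> 2 * t * a + t\<^sup>2 * b" for t
  proof -
    have "(v + t *\<^sub>R w) \<bullet> (B *v (v + t *\<^sub>R w)) = 2 * t * a + t\<^sup>2 * b"
      using v sw by (simp add: a_def b_def w_def[symmetric] matrix_vector_mult_scaleR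
          matrix_vector_right_distrib inner_add_left inner_add_right power2_eq_square algebra_simps)
    with psd show ?thesis by metis
  qed
  have "a \<ge> 0" "b \<ge> 0"
    using psd by (auto simp: a_def b_def)
  have "a = 0"
  proof (rule ccontr)
    assume "a \<noteq> 0"
    with \<open>a \<ge> 0\<close> have "a > 0" by simp
    \<comment> \<open>A step short enough for the linear term to win: at \<open>- t\<close> the
      quadratic equals \<open>t * (t * b - a * 2)\<close>, which is negative. The added 1 keeps the
      denominator positive when \<open>b\<close> is 0.\<close>
    define t where "t = a / (1 + b)"
    have t: "t > 0" "t * b < a * 2"
      using \<open>a > 0\<close> \<open>b \<ge> 0\<close> by (auto simp: t_def field_simps add_nonneg_pos)
    have "0 \<le> t * (t * b - a * 2)"
      using quad[of "- t"] by (simp add: power2_eq_square algebra_simps)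
    with t show False
      by (simp add: zero_le_mult_iff)
  qed
  then show ?thesis
    by (simp add: a_def w_def)
qed

text \<open>The quadratic form attains its maximum on the compact unit sphere, and the maximiser is
  an eigenvector. This supplies both the existence of eigenvalues and the Rayleigh bound.\<close>

lemma symmetric_top_eigenvalue:
  fixes M :: "real ^ 'n ^ 'n"
  assumes sym: "transpose M = M"
  obtains l where "l \<in> eigenvalues M" "\<And>x. x \<bullet> (M *v x) \<le> l * (x \<bullet> x)"
proof -
  let ?S = "sphere (0 :: real ^ 'n) 1"
  have "continuous_on ?S (\<lambda>x. x \<bullet> (M *v x))"
    by (intro continuous_intros linear_continuous_on matrix_vector_mul_bounded_linear)
  then obtain v where v: "v \<in> ?S" "\<And>x. x \<in> ?S \<Longrightarrow> x \<bullet> (M *v x) \<le> v \<bullet> (M *v v)"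
    using continuous_attains_sup[of ?S "\<lambda>x. x \<bullet> (M *v x)"] by (auto simp del: mem_sphere_0)
  define l where "l = v \<bullet> (M *v v)"
  have le: "x \<bullet> (M *v x) \<le> l * (x \<bullet> x)" for x
  proof (cases "x = 0")
    case False
    have "(x /\<^sub>R norm x) \<bullet> (M *v (x /\<^sub>R norm x)) \<le> l"
      unfolding l_def by (rule v(2)) (use False in simp)
    then have "(x \<bullet> (M *v x)) / (norm x)\<^sup>2 \<le> l"
      by (simp add: matrix_vector_mult_scaleR power2_eq_square field_simps)
    then show ?thesis
      using False by (simp add: field_simps power2_norm_eq_inner)
  qed simp
  \<comment> \<open>The shifted matrix has a nonnegative form that vanishes at the maximiser
    \<open>v\<close>, so \<open>v\<close> lies in its kernel.\<close>
  define B where "B = l *\<^sub>R mat 1 - M"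
  have B: "B *v x = l *\<^sub>R x - M *v x" for x
    by (simp add: B_def matrix_vector_mult_diff_rdistrib flip: scaleR_matrix_vector_assoc)
  have vv: "v \<bullet> v = 1"
    using v(1) by (simp add: norm_eq_1)
  have "B *v v = 0"
  proof (rule psd_null_vector)
    show "transpose B = B"
      using sym by (simp add: B_def transpose_def vec_eq_iff mat_def)
    show "0 \<le> x \<bullet> (B *v x)" for x
      using le[of x] by (simp add: B inner_diff_right)
    show "v \<bullet> (B *v v) = 0"
      using vv by (simp add: B inner_diff_right l_def)
  qed
  then have "l \<in> eigenvalues M"
    using vv unfolding eigenvalues_def by (intro CollectI exI[of _ v]) (auto simp: B)
  with le show thesis by (rule that[rotated])
qed

lemma rho_min_eigenvalue:
  assumes "transpose M = M"
  shows "rho_min M \<in> eigenvalues M"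
  unfolding rho_min_def
  using assms eigenvalues_finite symmetric_top_eigenvalue by (metis Min_in empty_iff)

section \<open>The spectral norm\<close>

lemma singular_values_finite: "finite (singular_values A)"
  unfolding singular_values_def by (intro finite_imageI eigenvalues_finite gram_symmetric)

lemma sqrt_le_spectral_norm:
  "l \<in> eigenvalues (transpose A ** A) \<Longrightarrow> sqrt l \<le> spectral_norm A"
  unfolding spectral_norm_def
  by (rule Max_ge[OF singular_values_finite]) (simp add: singular_values_def)

text \<open>The squared norm of \<open>A *v x\<close> is the quadratic form of the Gram matrix, so
  the Rayleigh bound for its top eigenvalue applies.\<close>

lemma norm_le_spectral_norm:
  fixes A :: "real ^ 'n ^ 'm"
  shows "norm (A *v x) \<le> spectral_norm A * norm x"
proof -
  obtain l where l: "l \<in> eigenvalues (transpose A ** A)"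
      and le: "\<And>x. x \<bullet> ((transpose A ** A) *v x) \<le> l * (x \<bullet> x)"
    using symmetric_top_eigenvalue[OF gram_symmetric] by metis
  have "(norm (A *v x))\<^sup>2 = x \<bullet> ((transpose A ** A) *v x)"
    by (simp add: power2_norm_eq_inner inner_transpose_right flip: matrix_vector_mul_assoc
        del: transpose_matrix_vector)
  also have "\<dots> \<le> l * (norm x)\<^sup>2"
    using le by (simp add: power2_norm_eq_inner)
  finally have "norm (A *v x) \<le> sqrt (l * (norm x)\<^sup>2)"
    by (rule real_le_rsqrt)
  also have "\<dots> = sqrt l * norm x"
    by (simp add: real_sqrt_mult)
  also have "\<dots> \<le> spectral_norm A * norm x"
    by (intro mult_right_mono sqrt_le_spectral_norm l) simp
  finally show ?thesis .
qed

lemma spectral_norm_nonneg: "0 \<le> spectral_norm (A :: real ^ 'n ^ 'm)"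
proof -
  \<comment> \<open>Here \<open>undefined\<close> serves as an arbitrary index, giving a vector of
    norm 1.\<close>
  have "0 \<le> norm (A *v axis undefined 1)" by simp
  also have "\<dots> \<le> spectral_norm A * 1"
    using norm_le_spectral_norm[of A "axis undefined 1"] by (simp add: norm_axis_1)
  finally show ?thesis by simp
qed

lemma spectral_norm_attained:
  fixes A :: "real ^ 'n ^ 'm"
  obtains l where "l \<in> eigenvalues (transpose A ** A)" "spectral_norm A = sqrt l"
proof -
  have "singular_values A \<noteq> {}"
    unfolding singular_values_def
    by (metis symmetric_top_eigenvalue[OF gram_symmetric] empty_iff image_is_empty)
  then have "spectral_norm A \<in> singular_values A"
    unfolding spectral_norm_def by (rule Max_in[OF singular_values_finite])
  then show thesis
    using that by (auto simp: singular_values_def)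
qed

text \<open>\<open>A\<close> carries an eigenvector of \<open>B ** A\<close> to one of
  \<open>A ** B\<close>; a nonzero eigenvalue guarantees that the image is nonzero.\<close>

lemma eigenvalues_commute:
  fixes A :: "real ^ 'n ^ 'm" and B :: "real ^ 'm ^ 'n"
  assumes "l \<in> eigenvalues (B ** A)" "l \<noteq> 0"
  shows "l \<in> eigenvalues (A ** B)"
proof -
  obtain v where v: "v \<noteq> 0" "B *v (A *v v) = l *\<^sub>R v"
    using assms(1) by (auto simp: eigenvalues_def simp flip: matrix_vector_mul_assoc)
  then have "A *v v \<noteq> 0"
    using assms(2) by auto
  moreover have "A *v (B *v (A *v v)) = l *\<^sub>R (A *v v)"
    using v by (simp add: matrix_vector_mult_scaleR)
  ultimately show ?thesis
    by (auto simp: eigenvalues_def simp flip: matrix_vector_mul_assoc)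
qed

lemma eigenvalue_near_one:
  fixes M :: "real ^ 'n ^ 'n"
  assumes "l \<in> eigenvalues M" "\<And>x. norm (x - M *v x) \<le> c * norm x"
  shows "\<bar>1 - l\<bar> \<le> c"
proof -
  obtain v where v: "v \<noteq> 0" "M *v v = l *\<^sub>R v"
    using assms(1) by (auto simp: eigenvalues_def)
  then have "v - M *v v = (1 - l) *\<^sub>R v"
    by (simp add: algebra_simps)
  then have "\<bar>1 - l\<bar> * norm v \<le> c * norm v"
    using assms(2)[of v] by simp
  with v show ?thesis by simp
qed

section \<open>The iteration\<close>

lemma newton_schulz_commute:
  fixes S :: "real ^ 'n ^ 'n" and Y Z :: "nat \<Rightarrow> real ^ 'n ^ 'n"
  assumes sym: "transpose S = S"
    and Y0: "Y 0 = S" and Z0: "Z 0 = mat 1"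
    and Y: "\<And>k. Y (Suc k) = (1 / 2) *\<^sub>R (Y k ** (3 *\<^sub>R mat 1 - Z k ** Y k))"
    and Z: "\<And>k. Z (Suc k) = (1 / 2) *\<^sub>R ((3 *\<^sub>R mat 1 - Z k ** Y k) ** Z k)"
  shows "Y k *v x = S *v (Z k *v x)"
    and "Z k *v (S *v x) = S *v (Z k *v x)"
    and "(Z k *v x) \<bullet> y = x \<bullet> (Z k *v y)"
    and "Z (Suc k) *v x = (1 / 2) *\<^sub>R (3 *\<^sub>R (Z k *v x) - S *v (Z k *v (Z k *v (Z k *v x))))"
proof -
  have S: "(S *v x) \<bullet> y = x \<bullet> (S *v y)" for x y
    using inner_transpose_right[of x S y] sym by simp
  have Yv: "Y (Suc k) *v x = (1 / 2) *\<^sub>R (3 *\<^sub>R (Y k *v x) - Y k *v (Z k *v (Y k *v x)))" for k x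
    by (simp add: Y matrix_vector_mult_diff_distrib matrix_vector_mult_diff_rdistrib matrix_vector_mult_scaleR
        flip: scaleR_matrix_vector_assoc matrix_vector_mul_assoc)
  have Zv: "Z (Suc k) *v x = (1 / 2) *\<^sub>R (3 *\<^sub>R (Z k *v x) - Z k *v (Y k *v (Z k *v x)))" for k x
    by (simp add: Z matrix_vector_mult_diff_distrib matrix_vector_mult_diff_rdistrib matrix_vector_mult_scaleR
        flip: scaleR_matrix_vector_assoc matrix_vector_mul_assoc)
  \<comment> \<open>The three facts are proved jointly: the induction step for self-adjointness uses
    the other two, at compound arguments.\<close>
  have main: "(\<forall>x. Y k *v x = S *v (Z k *v x)) \<and> (\<forall>x. Z k *v (S *v x) = S *v (Z k *v x))
      \<and> (\<forall>x y. (Z k *v x) \<bullet> y = x \<bullet> (Z k *v y))"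
  proof (induction k)
    case 0
    show ?case by (simp add: Y0 Z0)
  next
    case (Suc k)
    then show ?case
      by (simp add: Yv Zv S matrix_vector_mult_diff_distrib matrix_vector_mult_scaleR inner_diff_left
          inner_diff_right)
  qed
  then show "Y k *v x = S *v (Z k *v x)" "Z k *v (S *v x) = S *v (Z k *v x)"
      "(Z k *v x) \<bullet> y = x \<bullet> (Z k *v y)"
    by blast+
  show "Z (Suc k) *v x = (1 / 2) *\<^sub>R (3 *\<^sub>R (Z k *v x) - S *v (Z k *v (Z k *v (Z k *v x))))"
    using main by (simp add: Zv)
qed

text \<open>The recursion for the residual has no constant or linear term, and its coefficients 3/4
  and 1/4 sum to 1, so each step squares the bound.\<close>

lemma newton_schulz_residual:
  fixes S :: "real ^ 'n ^ 'n" and Y Z :: "nat \<Rightarrow> real ^ 'n ^ 'n"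
  assumes sym: "transpose S = S"
    and Y0: "Y 0 = S" and Z0: "Z 0 = mat 1"
    and Y: "\<And>k. Y (Suc k) = (1 / 2) *\<^sub>R (Y k ** (3 *\<^sub>R mat 1 - Z k ** Y k))"
    and Z: "\<And>k. Z (Suc k) = (1 / 2) *\<^sub>R ((3 *\<^sub>R mat 1 - Z k ** Y k) ** Z k)"
    and e: "0 \<le> e" "e \<le> 1" "\<And>x. norm (x - S *v x) \<le> e * norm x"
  shows "norm (x - Z k *v (S *v (Z k *v x))) \<le> e ^ (2 ^ k) * norm x"
proof (induction k arbitrary: x)
  case 0
  show ?case using e by (simp add: Z0)
next
  case (Suc k)
  note nsc = newton_schulz_commute[of S Y Z, OF sym Y0 Z0 Y Z]
  define R where "R x = x - Z k *v (S *v (Z k *v x))" for x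
  define c where "c = e ^ (2 ^ k)"
  have c: "0 \<le> c" "c \<le> 1"
    using e by (auto simp: c_def power_le_one)
  have R: "norm (R x) \<le> c * norm x" for x
    using Suc.IH by (simp add: R_def c_def)
  have RR: "norm (R (R x)) \<le> c\<^sup>2 * norm x"
    using order_trans[OF R[of "R x"] mult_left_mono[OF R[of x] c(1)]]
    by (simp add: power2_eq_square mult.assoc)
  have RRR: "norm (R (R (R x))) \<le> c\<^sup>2 * norm x"
    using order_trans[OF R[of "R (R x)"] mult_right_mono[OF c(2)]] RR by simp
  define P where "P x = S *v (Z k *v (Z k *v x))" for x
  have RP: "R x = x - P x" and P_diff: "P (x - y) = P x - P y" for x y
    by (simp_all add: R_def P_def nsc(2) matrix_vector_mult_diff_distrib)
  \<comment> \<open>As polynomials in commuting operators, this is the expansion of P (3 - P)^2 / 4;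
    substituting P = 1 - R then gives the residual recursion.\<close>
  have "Z (Suc k) *v (S *v (Z (Suc k) *v x))
      = (1 / 4) *\<^sub>R (9 *\<^sub>R P x - 3 *\<^sub>R P (P x) - 3 *\<^sub>R P (P x) + P (P (P x)))"
    unfolding nsc(4) P_def
    by (simp only: nsc(2) matrix_vector_mult_diff_distrib matrix_vector_mult_scaleR)
      (simp add: vec_eq_iff field_simps)
  then have "x - Z (Suc k) *v (S *v (Z (Suc k) *v x))
      = (3 / 4) *\<^sub>R R (R x) + (1 / 4) *\<^sub>R R (R (R x))"
    by (simp only: RP P_diff) (simp add: vec_eq_iff field_simps)
  also have "norm \<dots> \<le> (3 / 4) * norm (R (R x)) + (1 / 4) * norm (R (R (R x)))"
    by (rule order_trans[OF norm_triangle_ineq]) simp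
  also have "\<dots> \<le> c\<^sup>2 * norm x"
    using RR RRR by simp
  also have "c\<^sup>2 = e ^ (2 ^ Suc k)"
    by (simp add: c_def mult.commute flip: power_mult)
  finally show ?case .
qed

text \<open>The arithmetic-geometric mean inequality against 1 bounds the two roots by 1 + t/2 and 1
  - t/2.\<close>

lemma sqrt_add_sqrt_le_two:
  fixes t :: real
  assumes "\<bar>t\<bar> \<le> 1"
  shows "sqrt (1 + t) + sqrt (1 - t) \<le> 2"
  using assms arith_geo_mean_sqrt[of "1 + t" 1] arith_geo_mean_sqrt[of "1 - t" 1]
  by (simp add: abs_le_iff)

theorem theorem4:
  fixes V :: "real ^ 'n ^ 'n"
    and Y Z :: "nat \<Rightarrow> real ^ 'n ^ 'n"
    and kstar :: nat
  assumes "spectral_norm (mat 1 - V ** transpose V) < 1"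
    and "Y 0 = V ** transpose V"
    and "Z 0 = mat 1"
    and "\<And>k. Y (Suc k) = (1 / 2) *\<^sub>R (Y k ** (3 *\<^sub>R mat 1 - Z k ** Y k))"
    and "\<And>k. Z (Suc k) = (1 / 2) *\<^sub>R ((3 *\<^sub>R mat 1 - Z k ** Y k) ** Z k)"
  shows "spectral_norm (Z kstar ** V)
           \<le> 1 + spectral_norm V / sqrt (rho_min (V ** transpose V))
                 * (1 - sqrt (1 - spectral_norm (mat 1 - V ** transpose V) ^ (2 ^ kstar)))
       \<and> 1 + spectral_norm V / sqrt (rho_min (V ** transpose V))
                 * (1 - sqrt (1 - spectral_norm (mat 1 - V ** transpose V) ^ (2 ^ kstar)))
           \<le> 1 + spectral_norm V / sqrt (rho_min (V ** transpose V))
                 * spectral_norm (mat 1 - V ** transpose V) ^ (2 ^ kstar)"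
proof -
  define S where "S = V ** transpose V"
  define e where "e = spectral_norm (mat 1 - S)"
  define E where "E = e ^ (2 ^ kstar)"
  define q where "q = spectral_norm V / sqrt (rho_min S)"
  have sym: "transpose S = S"
    by (simp add: S_def matrix_transpose_mul)
  have e: "0 \<le> e" "e < 1"
    using assms(1) by (auto simp: e_def S_def spectral_norm_nonneg)
  have res0: "norm (x - S *v x) \<le> e * norm x" for x
    using norm_le_spectral_norm[of "mat 1 - S" x] by (simp add: e_def matrix_vector_mult_diff_rdistrib)
  have E: "0 \<le> E" "E \<le> 1"
    using e by (auto simp: E_def power_le_one)

  have "\<bar>1 - rho_min S\<bar> \<le> e"
    using rho_min_eigenvalue[OF sym] res0 by (rule eigenvalue_near_one)
  with e have rho_pos: "0 < rho_min S"
    by linarith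
  \<comment> \<open>The square root of \<open>rho_min S\<close> is therefore a singular value of
    \<open>V\<close>, hence at most its spectral norm.\<close>
  have "rho_min S \<in> eigenvalues (transpose V ** V)"
    using rho_min_eigenvalue[OF sym] rho_pos by (metis S_def eigenvalues_commute less_irrefl)
  then have q: "1 \<le> q"
    using rho_pos sqrt_le_spectral_norm[of "rho_min S" V] by (simp add: q_def)

  define Zk where "Zk = Z kstar"
  have Y0: "Y 0 = S"
    using assms(2) by (simp add: S_def)
  \<comment> \<open>Symmetry of \<open>Zk\<close> is what turns \<open>Zk ** V\<close> times its
    transpose into \<open>Zk ** S ** Zk\<close>, the matrix controlled by the residual
    bound.\<close>
  have Zsym: "transpose Zk = Zk"
  proof -
    have "transpose Zk *v x = Zk *v x" for x
    proof (rule vector_eq_rdot[THEN iffD1, rule_format])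
      fix y
      show "(transpose Zk *v x) \<bullet> y = (Zk *v x) \<bullet> y"
        using newton_schulz_commute(3)[of S Y Z, OF sym Y0 assms(3-5), of kstar y x]
          inner_transpose_right[of y Zk x]
        by (simp add: Zk_def inner_commute)
    qed
    then show ?thesis
      by (simp add: matrix_eq)
  qed
  have "spectral_norm (Zk ** V) \<le> sqrt (1 + E)"
  proof -
    let ?A = "Zk ** V"
    obtain m where m: "m \<in> eigenvalues (transpose ?A ** ?A)" "spectral_norm ?A = sqrt m"
      by (rule spectral_norm_attained)
    have "m \<le> 1 + E"
    \<comment> \<open>Only a nonzero eigenvalue can be moved to the other Gram matrix; for zero the
      bound is immediate.\<close>
    proof (cases "m = 0")
      case False
      have "m \<in> eigenvalues (?A ** transpose ?A)"
        using m(1) False by (rule eigenvalues_commute)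
      moreover have "(?A ** transpose ?A) *v x = Zk *v (S *v (Zk *v x))" for x
        by (simp add: S_def matrix_transpose_mul Zsym matrix_vector_mul_assoc matrix_mul_assoc)
      then have "norm (x - (?A ** transpose ?A) *v x) \<le> E * norm x" for x
        using newton_schulz_residual[of S Y Z e, OF sym Y0 assms(3-5) e(1) less_imp_le[OF e(2)] res0]
        by (simp add: Zk_def E_def)
      ultimately have "\<bar>1 - m\<bar> \<le> E"
        by (rule eigenvalue_near_one)
      then show ?thesis by linarith
    qed (use E in simp)
    then show ?thesis
      by (simp add: m(2))
  qed
  also have "\<dots> \<le> 1 + 1 * (1 - sqrt (1 - E))"
    using sqrt_add_sqrt_le_two[of E] E by simp
  also have "\<dots> \<le> 1 + q * (1 - sqrt (1 - E))"
    using q E by (intro add_left_mono mult_right_mono) auto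
  finally have "spectral_norm (Zk ** V) \<le> 1 + q * (1 - sqrt (1 - E))" .
  \<comment> \<open>On the unit interval a number is at most its square root; this yields the second
    inequality.\<close>
  moreover have "1 - E \<le> sqrt (1 - E)"
    using E by (intro real_le_rsqrt) (simp add: power2_eq_square mult_left_le)
  then have "1 + q * (1 - sqrt (1 - E)) \<le> 1 + q * E"
    using q by (intro add_left_mono mult_left_mono) auto
  ultimately show ?thesis
    by (simp add: Zk_def q_def E_def e_def S_def)
qed

end
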